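(* The map $\Delta^e:\mathcal H^e\to\mathcal H^e\otimes\mathcal H^{\mathrm{qed}}$ given by $$\Delta^e(s_1\ldots s_n):=(\delta^e\otimes\mathrm{Id})\,\Delta^p_e(s_1\ldots s_n)$$ is a right coaction of $\mathcal H^{\mathrm{qed}}$ on $\mathcal H^e$, i.e. it is coassociative with respect to $\Delta^{\mathrm{qed}}$: $$(\Delta^e\otimes\mathrm{Id})\,\Delta^e=(\mathrm{Id}\otimes\Delta^{\mathrm{qed}})\,\Delta^e .$$
   Context: All vector spaces and algebras are over $\mathbb C$. $Y=\bigcup_{n\ge0}Y_n$ is the set of planar binary trees, $Y_n$ being the trees with $n$ internal vertices; $|t|=n$ (the order) for $t\in Y_n$. $|$ denotes the unique tree of order $0$. $t\vee s$ is the tree obtained by grafting $t$ (left) and $s$ (right) on a new root; every tree other than $|$ is uniquely of the form $t^l\vee t^r$. $\mathbb CY$ is the vector space with basis $Y$, and $V:\mathbb CY\to\mathbb CY$ is the linear map $V(t)=|\vee t$. Over product: the associative product $/$ on $\mathbb CY$ given by $t/|=t$, $t/(s^l\vee s^r)=(t/s^l)\vee s^r$; unit $|$; $t\vee s=t/V(s)$; $(\mathbb CY,/)$ is the free associative algebra on the trees $V(t)$. On tensor products $/$ is applied componentwise. Linear maps $\widetilde\Delta,\widetilde\delta:\mathbb CY\to\mathbb CY\otimes\mathbb CY$ are defined by recursion on the order: $\widetilde\Delta(|)=\widetilde\delta(|)=|\otimes|$, $\ \widetilde\delta(V(t))=(V\otimes\mathrm{Id})\widetilde\delta(t)$, $\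 \widetilde\Delta(V(t))=|\otimes V(t)+\widetilde\delta(V(t))$, $\ \widetilde\Delta(t\vee s)=\widetilde\Delta(t)/\widetilde\Delta(V(s))$, $\ \widetilde\delta(t\vee s)=\widetilde\Delta(t)/\widetilde\delta(V(s))$. $\mathcal H^\alpha=\mathbb C[V(t),t\in Y]$ is the commutative polynomial algebra on the $V(t)$, identified with the abelianization of $(\mathbb CY,/)$ (unit $|$, product $/$), with quotient map $\pi:\mathbb CY\to\mathcal H^\alpha$; it is a Hopf algebra with coproduct the algebra morphism $\Delta^\alpha$ such that $\Delta^\alpha(V(t))=(\pi\otimes\pi)\widetilde\Delta(V(t))$. $\mathcal H^e=\mathbb C\langle Y\rangle/(1-|)$ is the free associative algebra on the set of trees with $|$ identified with the unit; its product is written by juxtaposition $s_1\ldots s_n$. It is a Hopf algebra with coproduct the algebra morphism $\Delta^p_e$ given on trees by $\Delta^p_e(|)=|\otimes|$ and $\Delta^p_e(t\vee s)=|\otimes(t\vee s)+\sum (t\vee s_{(1)})\otimes s_{(2)}$, where $\Delta^p_e(s)=\sum s_{(1)}\otimes s_{(2)}$. $\delta^e:\mathcal H^e\to\mathcal H^e\otimes\mathcal H^\alpha$ is the algebra morphism given on single trees by $\delta^e(t)=(\mathrm{Id}\otimes\pi)\widetilde\delta(t)$. $\mathcal H^{\mathrm{qed}}$ is the algebra $\mathcal H^\alpha\otimes\mathcal H^e$ with coproduct $\Delta^{\mathrm{qed}}(a\otimes b)=\sum \big(a_{(1)}\otimes (b_{(1)})_{(e)}\big)\otimes\big(a_{(2)}/(b_{(1)})_{(\alpha)}\otimes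 b_{(2)}\big)$, where $\Delta^\alpha(a)=\sum a_{(1)}\otimes a_{(2)}$, $\Delta^p_e(b)=\sum b_{(1)}\otimes b_{(2)}$, $\delta^e(b)=\sum b_{(e)}\otimes b_{(\alpha)}$. The target $\mathcal H^e\otimes\mathcal H^\alpha\otimes\mathcal H^e$ of $(\delta^e\otimes\mathrm{Id})\Delta^p_e$ is read as $\mathcal H^e\otimes\mathcal H^{\mathrm{qed}}$. *)

theory Defs
  imports
    Complex_Main
    "HOL-Library.Poly_Mapping"
    "HOL-Library.Product_Plus"
    "HOL-Library.Multiset"
begin

section \<open>Vector spaces with a basis\<close>

text \<open>
  Every space involved comes with a canonical basis, so \<open>'a vec\<close> is the complex vector space with
  basis \<open>'a\<close>. If \<open>'a\<close> is a monoid, written additively, the ring structure of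
  theory \<open>Poly_Mapping\<close> on \<open>'a vec\<close> is that of the monoid algebra: the product of two basis vectors is
  the basis vector of their sum, and the unit is the basis vector of \<open>0\<close>.

  The tensor product of \<open>'a vec\<close> and \<open>'b vec\<close> is \<open>('a \<times> 'b) vec\<close>, the pair \<open>(a, b)\<close> being the basis vector
  \<open>a \<otimes> b\<close>. As addition on pairs is componentwise, its ring structure is the componentwise product
  on the tensor product.
\<close>

type_synonym 'a vec = "'a \<Rightarrow>\<^sub>0 complex"

definition basis :: "'a \<Rightarrow> 'a vec"
  where "basis a = Poly_Mapping.single a 1"

definition scale :: "complex \<Rightarrow> 'a vec \<Rightarrow> 'a vec"
  where "scale c v = Poly_Mapping.map ((*) c) v"

definition lin :: "('a \<Rightarrow> 'b vec) \<Rightarrow> 'a vec \<Rightarrow> 'b vec"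
  where "lin f v = (\<Sum>a\<in>Poly_Mapping.keys v. scale (Poly_Mapping.lookup v a) (f a))"

definition tensor :: "'a vec \<Rightarrow> 'b vec \<Rightarrow> ('a \<times> 'b) vec"
  where "tensor v w = lin (\<lambda>a. lin (\<lambda>b. basis (a, b)) w) v"

text \<open>The tensor product of two maps, meaningful when both are linear.\<close>

definition tensor_map :: "('a vec \<Rightarrow> 'c vec) \<Rightarrow> ('b vec \<Rightarrow> 'd vec) \<Rightarrow> ('a \<times> 'b) vec \<Rightarrow> ('c \<times> 'd) vec"
  where "tensor_map f g = lin (\<lambda>(a, b). tensor (f (basis a)) (g (basis b)))"

definition tensor_assoc :: "(('a \<times> 'b) \<times> 'c) vec \<Rightarrow> ('a \<times> 'b \<times> 'c) vec"
  where "tensor_assoc = lin (\<lambda>((a, b), c). basis (a, b, c))"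


section \<open>Planar binary trees and the over product\<close>

datatype pbt = Leaf | Graft pbt pbt

text \<open>The sum of two trees is the over product \<open>t / s\<close>, so that \<open>pbt vec\<close> is the algebra
  \<open>(\<complex>Y, /)\<close> with unit \<open>Leaf\<close>.\<close>

primrec over :: "pbt \<Rightarrow> pbt \<Rightarrow> pbt"
  where
    "over t Leaf = t"
  | "over t (Graft l r) = Graft (over t l) r"

instantiation pbt :: monoid_add
begin

definition zero_pbt :: pbt
  where "zero_pbt = Leaf"

definition plus_pbt :: "pbt \<Rightarrow> pbt \<Rightarrow> pbt"
  where "plus_pbt = over"

instance
proof
  fix a b c :: pbt
  show "a + b + c = a + (b + c)"
    unfolding plus_pbt_def by (induction c) auto
  show "0 + a = a"
    unfolding plus_pbt_def zero_pbt_def by (induction a) auto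
  show "a + 0 = a"
    by (simp add: plus_pbt_def zero_pbt_def)
qed

end

definition V_tree :: "pbt \<Rightarrow> pbt"
  where "V_tree t = Graft Leaf t"

definition V :: "pbt vec \<Rightarrow> pbt vec"
  where "V = lin (\<lambda>t. basis (V_tree t))"

lemma Graft_eq_over_V_tree: "Graft t s = t + V_tree s"
  by (simp add: plus_pbt_def V_tree_def)


section \<open>The maps \<open>\<Delta>\<close>-tilde and \<open>\<delta>\<close>-tilde\<close>

text \<open>In the recursion the values at \<open>V_tree s\<close> are unfolded; the equations without this unfolding
  are derived below.\<close>

fun Delta_tilde_tree :: "pbt \<Rightarrow> (pbt \<times> pbt) vec"
  and delta_tilde_tree :: "pbt \<Rightarrow> (pbt \<times> pbt) vec"
  where
    "Delta_tilde_tree Leaf = basis (Leaf, Leaf)"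
  | "Delta_tilde_tree (Graft t s) =
       Delta_tilde_tree t * (basis (Leaf, V_tree s) + tensor_map V id (delta_tilde_tree s))"
  | "delta_tilde_tree Leaf = basis (Leaf, Leaf)"
  | "delta_tilde_tree (Graft t s) = Delta_tilde_tree t * tensor_map V id (delta_tilde_tree s)"

definition Delta_tilde :: "pbt vec \<Rightarrow> (pbt \<times> pbt) vec"
  where "Delta_tilde = lin Delta_tilde_tree"

definition delta_tilde :: "pbt vec \<Rightarrow> (pbt \<times> pbt) vec"
  where "delta_tilde = lin delta_tilde_tree"

lemma basis_Leaf_Leaf: "basis (Leaf, Leaf) = 1"
  by (simp add: basis_def single_one[symmetric] zero_prod_def zero_pbt_def)

lemma delta_tilde_tree_V:
  "delta_tilde_tree (V_tree t) = tensor_map V id (delta_tilde_tree t)"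
  by (simp add: V_tree_def basis_Leaf_Leaf)

lemma Delta_tilde_tree_V:
  "Delta_tilde_tree (V_tree t) = basis (Leaf, V_tree t) + delta_tilde_tree (V_tree t)"
  by (simp add: V_tree_def basis_Leaf_Leaf)

lemma Delta_tilde_tree_Graft:
  "Delta_tilde_tree (Graft t s) = Delta_tilde_tree t * Delta_tilde_tree (V_tree s)"
  by (simp add: Delta_tilde_tree_V delta_tilde_tree_V)

lemma delta_tilde_tree_Graft:
  "delta_tilde_tree (Graft t s) = Delta_tilde_tree t * delta_tilde_tree (V_tree s)"
  by (simp add: delta_tilde_tree_V)


section \<open>The Hopf algebra \<open>H\<^sup>\<alpha>\<close>\<close>

text \<open>The basis consists of the monomials in the variables \<open>V(t)\<close>: the multiset \<open>{#t\<^sub>1, \<dots>, t\<^sub>n#}\<close>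
  stands for \<open>V(t\<^sub>1) \<cdots> V(t\<^sub>n)\<close>.\<close>

type_synonym monomial = "pbt multiset"

primrec monomial_of :: "pbt \<Rightarrow> monomial"
  where
    "monomial_of Leaf = {#}"
  | "monomial_of (Graft t s) = monomial_of t + {#s#}"

lemma monomial_of_V_tree: "monomial_of (V_tree t) = {#t#}"
  by (simp add: V_tree_def)

lemma monomial_of_over: "monomial_of (t + s) = monomial_of t + monomial_of s"
  unfolding plus_pbt_def by (induction s) auto

definition proj_alpha :: "pbt vec \<Rightarrow> monomial vec"
  where "proj_alpha = lin (\<lambda>t. basis (monomial_of t))"

definition Delta_alpha :: "monomial vec \<Rightarrow> (monomial \<times> monomial) vec"
  where "Delta_alpha =
    lin (\<lambda>m. \<Prod>t\<in>#m. tensor_map proj_alpha proj_alpha (Delta_tilde (basis (V_tree t))))"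


section \<open>The Hopf algebra \<open>H\<^sup>e\<close>\<close>

text \<open>Identifying \<open>Leaf\<close> with the unit in the free associative algebra on all trees leaves the free
  associative algebra on the trees other than \<open>Leaf\<close>, whose basis is the free monoid below.\<close>

typedef word = "{ts :: pbt list. Leaf \<notin> set ts}"
  morphisms letters Word
  by (rule exI[of _ "[]"]) simp

setup_lifting type_definition_word

instantiation word :: monoid_add
begin

lift_definition zero_word :: word is "[]"
  by simp

lift_definition plus_word :: "word \<Rightarrow> word \<Rightarrow> word" is "(@)"
  by simp

instance
  by intro_classes (transfer, simp)+

end

text \<open>The class of a single tree.\<close>

lift_definition letter :: "pbt \<Rightarrow> word" is "\<lambda>t. if t = Leaf then [] else [t]"
  by auto

lemma letter_Leaf: "letter Leaf = 0"
  by transfer simp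

definition incl_e :: "pbt vec \<Rightarrow> word vec"
  where "incl_e = lin (\<lambda>t. basis (letter t))"

text \<open>The algebra morphism on \<open>H\<^sup>e\<close> with prescribed values on the trees other than \<open>Leaf\<close>.\<close>

definition alg_morph_e :: "(pbt \<Rightarrow> 'a::monoid_add vec) \<Rightarrow> word vec \<Rightarrow> 'a vec"
  where "alg_morph_e f = lin (\<lambda>w. \<Prod>t\<leftarrow>letters w. f t)"

text \<open>On trees, both tensor factors of \<open>\<Delta>\<^sup>p\<^sub>e\<close> are linear combinations of single trees. The recursion
  grafts onto the left one, hence takes place in \<open>\<complex>Y \<otimes> \<complex>Y\<close>.\<close>

primrec Delta_p_tree :: "pbt \<Rightarrow> (pbt \<times> pbt) vec"
  where
    "Delta_p_tree Leaf = basis (Leaf, Leaf)"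
  | "Delta_p_tree (Graft t s) =
       basis (Leaf, Graft t s) + tensor_map (lin (\<lambda>u. basis (Graft t u))) id (Delta_p_tree s)"

definition Delta_p :: "word vec \<Rightarrow> (word \<times> word) vec"
  where "Delta_p = alg_morph_e (\<lambda>t. tensor_map incl_e incl_e (Delta_p_tree t))"

definition delta_e :: "word vec \<Rightarrow> (word \<times> monomial) vec"
  where "delta_e = alg_morph_e (\<lambda>t. tensor_map incl_e proj_alpha (delta_tilde (basis t)))"


section \<open>The algebra \<open>H\<^sup>q\<^sup>e\<^sup>d\<close> and the map \<open>\<Delta>\<^sup>e\<close>\<close>

type_synonym qed_basis = "monomial \<times> word"

text \<open>In the variable pattern, \<open>a1\<close>, \<open>a2\<close> are the factors of \<open>\<Delta>\<^sup>\<alpha>(a)\<close>, and \<open>b1e\<close>, \<open>b1a\<close>, \<open>b2\<close> those of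
  \<open>(\<delta>\<^sup>e \<otimes> Id) \<Delta>\<^sup>p\<^sub>e(b)\<close>; the sum \<open>a2 + b1a\<close> is the product of two monomials.\<close>

definition Delta_qed :: "qed_basis vec \<Rightarrow> (qed_basis \<times> qed_basis) vec"
  where "Delta_qed =
    lin (\<lambda>((a1, a2), ((b1e, b1a), b2)). basis ((a1, b1e), (a2 + b1a, b2)))
    \<circ> tensor_map Delta_alpha (tensor_map delta_e id \<circ> Delta_p)"

definition Delta_e :: "word vec \<Rightarrow> (word \<times> qed_basis) vec"
  where "Delta_e = tensor_assoc \<circ> tensor_map delta_e id \<circ> Delta_p"

end

theory Submission
  imports Defs
begin

text \<open>
  Three facts make \<open>H\<^sup>e\<close>, with the coproduct \<open>\<Delta>\<^sup>p\<^sub>e\<close>, a coalgebra in the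
  category of right comodules over \<open>H\<^sup>\<alpha>\<close>:
  \<^item> \<open>\<delta>\<^sup>e\<close> is a coaction, \<open>(\<delta>\<^sup>e \<otimes> Id) \<delta>\<^sup>e = (Id \<otimes> \<Delta>\<^sup>\<alpha>) \<delta>\<^sup>e\<close> (\<open>delta_word_coaction\<close>);
  \<^item> \<open>\<Delta>\<^sup>p\<^sub>e\<close> is coassociative (\<open>Delta_p_word_coassoc\<close>);
  \<^item> \<open>\<Delta>\<^sup>p\<^sub>e\<close> is a map of comodules, where the square of \<open>H\<^sup>e\<close> carries the diagonal coaction
    \<open>b \<otimes> c \<mapsto> b\<^sub>e \<otimes> c\<^sub>e \<otimes> b\<^sub>\<alpha> c\<^sub>\<alpha>\<close> (\<open>delta_Delta_p_compatible\<close>).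

  For any such coalgebra \<open>\<Delta>\<^sup>q\<^sup>e\<^sup>d\<close> is the smash coproduct, and the claim is formal: in
  \<open>(\<Delta>\<^sup>e \<otimes> Id) \<Delta>\<^sup>e\<close> the third fact moves \<open>\<Delta>\<^sup>p\<^sub>e\<close> in front of \<open>\<delta>\<^sup>e\<close>, the first one replaces the
  iterated \<open>\<delta>\<^sup>e\<close> by \<open>\<Delta>\<^sup>\<alpha>\<close>, the second one rebrackets the iterated \<open>\<Delta>\<^sup>p\<^sub>e\<close>, and the result is
  \<open>(Id \<otimes> \<Delta>\<^sup>q\<^sup>e\<^sup>d) \<Delta>\<^sup>e\<close>.

  All maps in the three facts are algebra morphisms on a free algebra, so it suffices to compare them
  on single trees. There they hold before passing to the commutative algebra \<open>H\<^sup>\<alpha>\<close>, and are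
  proved by induction on the tree (\<open>tilde_coassoc\<close>, \<open>coassoc_p_tree\<close>, \<open>delta_p_compatible_tree\<close>).
  On words, commutativity of \<open>H\<^sup>\<alpha>\<close> is what makes the diagonal coaction multiplicative.

  The calculations rest on \<open>'a vec\<close> being a commutative monad with unit \<open>basis\<close> and bind \<open>lin\<close>:
  Sweedler notation becomes nested \<open>lin\<close>, which the monad laws normalise, and independent
  Sweedler indices are exchanged by \<open>lin_swap\<close>.
\<close>

section \<open>Linear extension as a commutative monad\<close>

lemma lookup_scale [simp]: "Poly_Mapping.lookup (scale c v) a = c * Poly_Mapping.lookup v a"
  by (simp add: scale_def Poly_Mapping.map.rep_eq when_def)

lemma scale_zero [simp]: "scale 0 v = 0" "scale c 0 = 0"
  by (rule poly_mapping_eqI; simp)+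

lemma scale_one [simp]: "scale 1 v = v"
  by (rule poly_mapping_eqI) simp

lemma scale_add_left: "scale (c + d) v = scale c v + scale d v"
  by (rule poly_mapping_eqI) (simp add: lookup_add algebra_simps)

lemma scale_add_right: "scale c (v + w) = scale c v + scale c w"
  by (rule poly_mapping_eqI) (simp add: lookup_add algebra_simps)

lemma scale_scale [simp]: "scale c (scale d v) = scale (c * d) v"
  by (rule poly_mapping_eqI) (simp add: algebra_simps)

lemma scale_sum: "scale c (sum f A) = (\<Sum>a\<in>A. scale c (f a))"
  by (induction A rule: infinite_finite_induct) (simp_all add: scale_add_right)

lemma scale_basis: "scale c (basis a) = Poly_Mapping.single a c"
  by (rule poly_mapping_eqI) (simp add: basis_def lookup_single when_def)

lemma scale_single: "scale c (Poly_Mapping.single a d) = Poly_Mapping.single a (c * d)"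
  by (rule poly_mapping_eqI) (simp add: lookup_single when_def)

lemma lin_superset:
  assumes "finite A" "Poly_Mapping.keys v \<subseteq> A"
  shows "lin f v = (\<Sum>a\<in>A. scale (Poly_Mapping.lookup v a) (f a))"
  unfolding lin_def by (rule sum.mono_neutral_left) (use assms in \<open>auto simp: in_keys_iff\<close>)

lemma lin_basis [simp]: "lin f (basis a) = f a"
  by (simp add: lin_def basis_def)

lemma lin_zero [simp]: "lin f 0 = 0"
  by (simp add: lin_def)

lemma lin_add: "lin f (v + w) = lin f v + lin f w"
proof -
  let ?A = "Poly_Mapping.keys v \<union> Poly_Mapping.keys w"
  have "Poly_Mapping.keys (v + w) \<subseteq> ?A"
    by (rule keys_add)
  then show ?thesis
    by (simp add: lin_superset[of ?A] lookup_add scale_add_left sum.distrib)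
qed

lemma lin_scale: "lin f (scale c v) = scale c (lin f v)"
proof -
  have "Poly_Mapping.keys (scale c v) \<subseteq> Poly_Mapping.keys v"
    by (auto simp: in_keys_iff)
  then show ?thesis
    by (simp add: lin_superset[of "Poly_Mapping.keys v"] scale_sum)
qed

lemma lin_sum: "lin f (sum g A) = (\<Sum>a\<in>A. lin f (g a))"
  by (induction A rule: infinite_finite_induct) (simp_all add: lin_add)

lemma lin_lin [simp]: "lin f (lin g v) = lin (\<lambda>a. lin f (g a)) v"
  by (simp add: lin_def[of g] lin_sum lin_scale) (simp add: lin_def)

lemma sum_single:
  fixes v :: "'a vec"
  shows "(\<Sum>a\<in>Poly_Mapping.keys v. Poly_Mapping.single a (Poly_Mapping.lookup v a)) = v"
  by (rule poly_mapping_eqI)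
    (auto simp: lookup_sum lookup_single when_def in_keys_iff sum.delta)

lemma lin_return [simp]: "lin basis v = v"
  by (simp add: lin_def scale_basis sum_single)

lemma lin_add_fun: "lin (\<lambda>a. f a + g a) v = lin f v + lin g v"
  by (simp add: lin_def scale_add_right sum.distrib)

lemma lin_swap: "lin (\<lambda>a. lin (\<lambda>b. f a b) w) v = lin (\<lambda>b. lin (\<lambda>a. f a b) v) w"
  unfolding lin_def scale_sum
  by (subst sum.swap) (simp add: mult.commute)

text \<open>Two independent blocks are exchanged, each consisting of an index and a second index that
  depends on it.\<close>

lemma lin_swap_dependent:
  "lin (\<lambda>p. lin (\<lambda>q. lin (\<lambda>x. lin (\<lambda>y. f p q x y) (A x)) v) (B p)) w =
    lin (\<lambda>x. lin (\<lambda>y. lin (\<lambda>p. lin (\<lambda>q. f p q x y) (B p)) w) (A x)) v"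
  using lin_swap[of "\<lambda>u z. f (fst u) (snd u) (fst z) (snd z)"
      "lin (\<lambda>x. lin (\<lambda>y. basis (x, y)) (A x)) v" "lin (\<lambda>p. lin (\<lambda>q. basis (p, q)) (B p)) w"]
  by simp

lemma times_eq_lin: "v * w = lin (\<lambda>a. lin (\<lambda>b. basis (a + b)) w) v"
proof -
  have "v * w = (\<Sum>a\<in>Poly_Mapping.keys v. Poly_Mapping.single a (Poly_Mapping.lookup v a)) *
      (\<Sum>b\<in>Poly_Mapping.keys w. Poly_Mapping.single b (Poly_Mapping.lookup w b))"
    by (simp add: sum_single)
  then show ?thesis
    unfolding lin_def by (simp add: sum_product mult_single scale_sum scale_basis scale_single)
qed

lemma basis_times_basis [simp]: "basis a * basis b = basis (a + b)"
  by (simp add: basis_def mult_single)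

lemma basis_zero [simp]: "basis 0 = 1"
  by (simp add: basis_def)

lemma lin_one [simp]: "lin f 1 = f 0"
  unfolding basis_zero[symmetric] by (rule lin_basis)

lemma zero_pair [simp]: "(0, 0) = 0"
  by (simp add: zero_prod_def)

lemma tensor_map_eq_lin:
  "tensor_map f g v =
    lin (\<lambda>x. lin (\<lambda>c. lin (\<lambda>d. basis (c, d)) (g (basis (snd x)))) (f (basis (fst x)))) v"
  by (simp add: tensor_map_def tensor_def split_beta')


section \<open>Multiplicative maps\<close>

definition multiplicative :: "('a::monoid_add \<Rightarrow> 'b::monoid_add vec) \<Rightarrow> bool"
  where "multiplicative f \<longleftrightarrow> f 0 = 1 \<and> (\<forall>a b. f (a + b) = f a * f b)"

text \<open>The maps \<open>f\<close> and \<open>h\<close> may differ, because \<open>delta_tilde_tree\<close> is not multiplicative for the over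
  product: it turns \<open>t / V(s)\<close> into a product with the \<^emph>\<open>other\<close> map, \<open>Delta_tilde_tree\<close>, on the first
  factor. The restriction to the image of \<open>\<phi>\<close> allows right factors of the form \<open>V(s)\<close> only.\<close>

lemma lin_times_image:
  assumes "\<And>a b. h (a + \<phi> b) = f a * g b"
  shows "lin h (v * lin (\<lambda>b. basis (\<phi> b)) w) = lin f v * lin g w"
proof -
  have "lin h (v * lin (\<lambda>b. basis (\<phi> b)) w) = lin (\<lambda>a. lin (\<lambda>b. f a * g b) w) v"
    by (simp add: times_eq_lin[of v] assms)
  also have "\<dots> = lin f v * lin g w"
    unfolding times_eq_lin lin_lin
    by (subst lin_swap[of _ w]) simp
  finally show ?thesis .
qed

lemma lin_times:
  assumes "\<And>a b. h (a + b) = f a * g b"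
  shows "lin h (v * w) = lin f v * lin g w"
  using lin_times_image[of h "\<lambda>b. b" f g v w] assms by simp

lemma lin_multiplicative: "multiplicative f \<Longrightarrow> lin f (v * w) = lin f v * lin f w"
  by (rule lin_times) (simp add: multiplicative_def)

lemma multiplicative_lin:
  assumes "multiplicative f" "multiplicative g"
  shows "multiplicative (\<lambda>a. lin g (f a))"
  using assms unfolding multiplicative_def
  by (metis lin_times lin_basis basis_zero)

lemma multiplicative_basis:
  assumes "\<phi> 0 = 0" "\<And>a b. \<phi> (a + b) = \<phi> a + \<phi> b"
  shows "multiplicative (\<lambda>a. basis (\<phi> a))"
  using assms by (simp add: multiplicative_def)

lemma tensor_eq_lin: "tensor v w = lin (\<lambda>a. lin (\<lambda>b. basis (a, b)) w) v"
  by (simp add: tensor_def)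

lemma tensor_times: "tensor (v * v') (w * w') = tensor v w * tensor v' w'"
proof -
  have "tensor (v * v') (w * w') =
      lin (\<lambda>a. lin (\<lambda>a'. lin (\<lambda>b. lin (\<lambda>b'. basis (a + a', b + b')) w') w) v') v"
    by (simp add: tensor_eq_lin times_eq_lin)
  also have "\<dots> = lin (\<lambda>a. lin (\<lambda>b. lin (\<lambda>a'. lin (\<lambda>b'. basis (a + a', b + b')) w') v') w) v"
    by (subst lin_swap[of _ w]) simp
  also have "\<dots> = tensor v w * tensor v' w'"
    by (simp add: tensor_eq_lin times_eq_lin[of "lin _ _"])
  finally show ?thesis .
qed

lemma tensor_one [simp]: "tensor 1 1 = 1"
  by (simp add: tensor_eq_lin)

lemma multiplicative_tensor:
  assumes "multiplicative f" "multiplicative g"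
  shows "multiplicative (\<lambda>x. tensor (f (fst x)) (g (snd x)))"
  using assms by (simp add: multiplicative_def tensor_times)

lemma multiplicative_basis_id: "multiplicative basis"
  by (simp add: multiplicative_def)

lemma multiplicative_on_left:
  assumes "multiplicative f"
  shows "multiplicative (\<lambda>x. lin (\<lambda>y. basis (fst y, snd y, snd x)) (f (fst x)))"
proof -
  have "multiplicative (\<lambda>x. lin (\<lambda>z. basis (fst (fst z), snd (fst z), snd z))
      (tensor (f (fst x)) (basis (snd x))))"
    by (intro multiplicative_lin multiplicative_tensor multiplicative_basis assms
        multiplicative_basis_id) simp_all
  then show ?thesis
    by (simp add: tensor_eq_lin)
qed

lemma multiplicative_on_right:
  assumes "multiplicative f"
  shows "multiplicative (\<lambda>x. lin (\<lambda>y. basis (fst x, y)) (f (snd x)))"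
proof -
  have "multiplicative (\<lambda>x. tensor (basis (fst x)) (f (snd x)))"
    by (intro multiplicative_tensor assms multiplicative_basis_id)
  then show ?thesis
    by (simp add: tensor_eq_lin)
qed


section \<open>Coassociativity and the coaction on trees\<close>

lemma plus_Graft: "a + Graft b c = Graft (a + b) c"
  by (simp add: plus_pbt_def)

lemma tensor_map_V_id: "tensor_map V id v = lin (\<lambda>x. basis (V_tree (fst x), snd x)) v"
  by (simp add: tensor_map_eq_lin V_def)

lemma Leaf_eq_zero: "Leaf = 0"
  by (simp add: zero_pbt_def)

lemma coproducts_zero [simp]:
  "Delta_tilde_tree 0 = 1" "delta_tilde_tree 0 = 1" "Delta_p_tree 0 = 1"
  by (simp_all add: basis_Leaf_Leaf flip: Leaf_eq_zero)

lemma multiplicative_Delta_tilde: "multiplicative Delta_tilde_tree"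
proof -
  have "Delta_tilde_tree (a + b) = Delta_tilde_tree a * Delta_tilde_tree b" for a b
    by (induction b)
      (simp_all add: plus_Graft mult.assoc, simp add: Leaf_eq_zero)
  then show ?thesis
    by (simp add: multiplicative_def basis_Leaf_Leaf flip: Leaf_eq_zero)
qed

lemma delta_tilde_Graft:
  "delta_tilde_tree (Graft t s) =
    Delta_tilde_tree t * lin (\<lambda>x. basis (V_tree (fst x), snd x)) (delta_tilde_tree s)"
  by (simp add: tensor_map_V_id)

lemma delta_tilde_V:
  "delta_tilde_tree (V_tree t) = lin (\<lambda>x. basis (V_tree (fst x), snd x)) (delta_tilde_tree t)"
  by (simp add: delta_tilde_tree_V tensor_map_V_id)

text \<open>These are \<open>f \<otimes> Id\<close> and \<open>Id \<otimes> f\<close>, landing in the same bracketing of the triple tensor product so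
  that they can be compared.\<close>

definition act_left :: "('a \<Rightarrow> ('b \<times> 'c) vec) \<Rightarrow> ('a \<times> 'd) vec \<Rightarrow> ('b \<times> 'c \<times> 'd) vec"
  where "act_left f = lin (\<lambda>x. lin (\<lambda>y. basis (fst y, snd y, snd x)) (f (fst x)))"

definition act_right :: "('a \<Rightarrow> ('b \<times> 'c) vec) \<Rightarrow> ('d \<times> 'a) vec \<Rightarrow> ('d \<times> 'b \<times> 'c) vec"
  where "act_right f = lin (\<lambda>x. lin (\<lambda>y. basis (fst x, y)) (f (snd x)))"

lemma act_left_times: "multiplicative f \<Longrightarrow> act_left f (v * w) = act_left f v * act_left f w"
  unfolding act_left_def by (rule lin_multiplicative[OF multiplicative_on_left])

lemma act_right_times: "multiplicative f \<Longrightarrow> act_right f (v * w) = act_right f v * act_right f w"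
  unfolding act_right_def by (rule lin_multiplicative[OF multiplicative_on_right])

text \<open>This is \<open>\<delta>(t \<or> s) = \<Delta>(t) / \<delta>(V(s))\<close>, for the maps with tilde, in the first tensor factor: the
  first factor of \<open>w\<close> has been put below a new root by \<open>V\<close>.\<close>

lemma act_left_delta_tilde_times:
  fixes v w :: "(pbt \<times> 'd::monoid_add) vec"
  shows "act_left delta_tilde_tree (v * lin (\<lambda>x. basis (V_tree (fst x), snd x)) w) =
    act_left Delta_tilde_tree v *
      act_left delta_tilde_tree (lin (\<lambda>x. basis (V_tree (fst x), snd x)) w)"
proof -
  have "lin (\<lambda>y. basis (fst y, snd y, b + d)) (delta_tilde_tree (a + V_tree c)) =
    lin (\<lambda>y. basis (fst y, snd y, b)) (Delta_tilde_tree a) *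
      lin (\<lambda>y. basis (fst y, snd y, d)) (delta_tilde_tree (V_tree c))" for a c and b d :: 'd
    unfolding Graft_eq_over_V_tree[symmetric] delta_tilde_tree_Graft
    by (rule lin_times) simp
  then show ?thesis
    unfolding act_left_def by (subst lin_times_image) auto
qed

text \<open>By definition \<open>\<delta> V = (V \<otimes> Id) \<delta>\<close> for \<open>\<delta>\<close>-tilde, so that \<open>V \<otimes> Id \<otimes> Id\<close> carries the identity
  for \<open>s\<close> to the one for \<open>V(s)\<close>.\<close>

lemma coaction_tilde_V:
  assumes "act_left delta_tilde_tree (delta_tilde_tree s) =
    act_right Delta_tilde_tree (delta_tilde_tree s)"
  shows "act_left delta_tilde_tree (delta_tilde_tree (V_tree s)) =
    act_right Delta_tilde_tree (delta_tilde_tree (V_tree s))"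
  using arg_cong[OF assms, of "lin (\<lambda>x. basis (V_tree (fst x), snd x))"]
  by (simp add: act_left_def act_right_def delta_tilde_V)

text \<open>On \<open>V(s)\<close> the coproduct \<open>\<Delta>\<close>-tilde differs from \<open>\<delta>\<close>-tilde by the term \<open>| \<otimes> V(s)\<close>, whose
  contributions to the two sides agree.\<close>

lemma coassoc_tilde_V:
  assumes "act_left delta_tilde_tree (delta_tilde_tree s) =
    act_right Delta_tilde_tree (delta_tilde_tree s)"
  shows "act_left Delta_tilde_tree (Delta_tilde_tree (V_tree s)) =
    act_right Delta_tilde_tree (Delta_tilde_tree (V_tree s))"
  using coaction_tilde_V[OF assms]
  by (simp add: act_left_def act_right_def Delta_tilde_tree_V lin_add lin_add_fun delta_tilde_V
     add.assoc)

text \<open>Both identities have to be proved together, because \<open>\<Delta>\<close>-tilde and \<open>\<delta>\<close>-tilde are defined by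
  mutual recursion: on \<open>t \<or> s\<close> each of them uses the first identity at \<open>t\<close> and the second at \<open>s\<close>.\<close>

lemma tilde_coassoc:
  "act_left Delta_tilde_tree (Delta_tilde_tree t) = act_right Delta_tilde_tree (Delta_tilde_tree t) \<and>
   act_left delta_tilde_tree (delta_tilde_tree t) = act_right Delta_tilde_tree (delta_tilde_tree t)"
proof (induction t)
  case Leaf
  show ?case
    by (simp add: act_left_def act_right_def Leaf_eq_zero)
next
  case (Graft t s)
  have "act_left Delta_tilde_tree (Delta_tilde_tree (Graft t s)) =
      act_right Delta_tilde_tree (Delta_tilde_tree (Graft t s))"
    using Graft coassoc_tilde_V[of s]
    by (simp add: Delta_tilde_tree_Graft act_left_times act_right_times multiplicative_Delta_tilde
        del: Delta_tilde_tree.simps)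
  moreover have "act_left delta_tilde_tree (delta_tilde_tree (Graft t s)) =
      act_right Delta_tilde_tree (delta_tilde_tree (Graft t s))"
    using Graft coaction_tilde_V[of s]
    by (simp only: delta_tilde_Graft act_left_delta_tilde_times act_right_times delta_tilde_V
        multiplicative_Delta_tilde)
  ultimately show ?case ..
qed


section \<open>The coproduct \<open>\<Delta>\<^sup>p\<^sub>e\<close> on trees\<close>

text \<open>The diagonal coaction \<open>b \<otimes> c \<mapsto> b\<^sub>e \<otimes> c\<^sub>e \<otimes> b\<^sub>\<alpha> c\<^sub>\<alpha>\<close> for \<open>f(b) = b\<^sub>e \<otimes> b\<^sub>\<alpha>\<close>.\<close>

definition act_diag :: "('a \<Rightarrow> ('b \<times> 'c::monoid_add) vec) \<Rightarrow> ('a \<times> 'a) vec \<Rightarrow> ('b \<times> 'b \<times> 'c) vec"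
  where "act_diag f = lin (\<lambda>x. lin (\<lambda>y. lin (\<lambda>z.
    basis (fst y, fst z, snd y + snd z)) (f (snd x))) (f (fst x)))"

lemma Delta_p_Graft:
  "Delta_p_tree (Graft t s) =
    basis (Leaf, Graft t s) + lin (\<lambda>x. basis (Graft t (fst x), snd x)) (Delta_p_tree s)"
  by (simp add: tensor_map_eq_lin)

lemma coassoc_p_tree: "act_left Delta_p_tree (Delta_p_tree t) = act_right Delta_p_tree (Delta_p_tree t)"
proof (induction t)
  case Leaf
  show ?case
    by (simp add: act_left_def act_right_def Leaf_eq_zero)
next
  case (Graft t s)
  show ?case
    using arg_cong[OF Graft(2), of "lin (\<lambda>x. basis (Graft t (fst x), snd x))"]
    by (simp add: act_left_def act_right_def Delta_p_Graft lin_add lin_add_fun add.assoc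
        del: Delta_p_tree.simps(2))
qed

lemma delta_tilde_Graft_eq_lin:
  "delta_tilde_tree (Graft t s) =
    lin (\<lambda>u. lin (\<lambda>x. basis (Graft (fst u) (fst x), snd u + snd x)) (delta_tilde_tree s))
      (Delta_tilde_tree t)"
  unfolding delta_tilde_Graft by (simp add: times_eq_lin plus_prod_def Graft_eq_over_V_tree)

text \<open>On \<open>t \<or> s\<close>, write \<open>\<Delta>(t) = u\<^sub>1 \<otimes> u\<^sub>2\<close> for \<open>\<Delta>\<close>-tilde, so that \<open>\<delta>(t \<or> s) = (u\<^sub>1 \<or> s\<^sub>e) \<otimes> (u\<^sub>2 / s\<^sub>\<alpha>)\<close>.
  The coproduct \<open>\<Delta>\<^sup>p\<^sub>e\<close> cuts only along the right branch, hence leaves the factor \<open>u\<close> intact, and the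
  induction hypothesis for \<open>s\<close> applies. As \<open>u\<^sub>2\<close> comes first in every product, commutativity of the
  over product is not involved.\<close>

lemma delta_p_compatible_tree:
  "act_left Delta_p_tree (delta_tilde_tree t) = act_diag delta_tilde_tree (Delta_p_tree t)"
proof (induction t)
  case Leaf
  show ?case
    by (simp add: act_left_def act_diag_def Leaf_eq_zero)
next
  case (Graft t s)
  \<comment> \<open>restores the factor \<open>u\<close>: \<open>b \<otimes> c \<otimes> m \<mapsto> (u\<^sub>1 \<or> b) \<otimes> c \<otimes> (u\<^sub>2 / m)\<close>\<close>
  let ?g = "\<lambda>u. lin (\<lambda>z. basis (Graft (fst u) (fst z), fst (snd z), snd u + snd (snd z)))"
  have "act_left Delta_p_tree (delta_tilde_tree (Graft t s)) =
      lin (\<lambda>z. basis (Leaf, z)) (delta_tilde_tree (Graft t s)) +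
      lin (\<lambda>u. ?g u (act_left Delta_p_tree (delta_tilde_tree s))) (Delta_tilde_tree t)"
    by (simp add: act_left_def delta_tilde_Graft_eq_lin Delta_p_Graft lin_add lin_add_fun
        del: Delta_p_tree.simps(2) delta_tilde_tree.simps(2))
  also have "\<dots> = lin (\<lambda>z. basis (Leaf, z)) (delta_tilde_tree (Graft t s)) +
      lin (\<lambda>x. lin (\<lambda>u. ?g u (act_diag delta_tilde_tree (basis x))) (Delta_tilde_tree t))
        (Delta_p_tree s)"
    by (subst lin_swap) (simp add: Graft(2) act_diag_def)
  also have "\<dots> = act_diag delta_tilde_tree (Delta_p_tree (Graft t s))"
    by (simp add: act_diag_def delta_tilde_Graft_eq_lin Delta_p_Graft lin_add add.assoc Leaf_eq_zero
        del: Delta_p_tree.simps(2) delta_tilde_tree.simps(2))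
  finally show ?case .
qed

section \<open>From trees to words\<close>

definition word_map :: "(pbt \<Rightarrow> 'a::monoid_add vec) \<Rightarrow> word \<Rightarrow> 'a vec"
  where "word_map f w = (\<Prod>t\<leftarrow>letters w. f t)"

lemma multiplicative_word_map: "multiplicative (word_map f)"
  by (simp add: multiplicative_def word_map_def zero_word.rep_eq plus_word.rep_eq)

lemma word_map_letter: "f Leaf = 1 \<Longrightarrow> word_map f (letter t) = f t"
  by (simp add: word_map_def letter.rep_eq)

lemma word_induct:
  assumes "P 0" "\<And>t w. P w \<Longrightarrow> P (letter t + w)"
  shows "P w"
proof -
  have "P (Word ts)" if "Leaf \<notin> set ts" for ts
    using that
  proof (induction ts)
    case Nil
    then show ?case
      using assms(1) by (simp add: zero_word_def)
  next
    case (Cons t ts)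
    then have "Word (t # ts) = letter t + Word ts"
      by (auto simp flip: letters_inject simp: plus_word.rep_eq letter.rep_eq Word_inverse)
    with Cons assms(2) show ?case
      by simp
  qed
  from this[of "letters w"] letters[of w] show ?thesis
    by (simp add: letters_inverse)
qed

lemma multiplicative_word_eqI:
  assumes "multiplicative f" "multiplicative g" "\<And>t. f (letter t) = g (letter t)"
  shows "f w = g w"
  by (induction w rule: word_induct) (use assms in \<open>simp_all add: multiplicative_def\<close>)

definition delta_word :: "word \<Rightarrow> (word \<times> monomial) vec"
  where "delta_word =
    word_map (\<lambda>t. lin (\<lambda>x. basis (letter (fst x), monomial_of (snd x))) (delta_tilde_tree t))"

definition Delta_p_word :: "word \<Rightarrow> (word \<times> word) vec"
  where "Delta_p_word =
    word_map (\<lambda>t. lin (\<lambda>x. basis (letter (fst x), letter (snd x))) (Delta_p_tree t))"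

definition Delta_alpha_monomial :: "monomial \<Rightarrow> (monomial \<times> monomial) vec"
  where "Delta_alpha_monomial m = (\<Prod>t\<in>#m.
    lin (\<lambda>x. basis (monomial_of (fst x), monomial_of (snd x))) (Delta_tilde_tree (V_tree t)))"

lemma delta_e_eq_lin: "delta_e = lin delta_word"
  by (simp add: delta_e_def alg_morph_e_def delta_word_def word_map_def[abs_def] tensor_map_eq_lin
      delta_tilde_def incl_e_def proj_alpha_def)

lemma Delta_p_eq_lin: "Delta_p = lin Delta_p_word"
  by (simp add: Delta_p_def alg_morph_e_def Delta_p_word_def word_map_def[abs_def] tensor_map_eq_lin
      incl_e_def)

lemma Delta_alpha_eq_lin: "Delta_alpha = lin Delta_alpha_monomial"
  by (simp add: Delta_alpha_def Delta_alpha_monomial_def[abs_def] tensor_map_eq_lin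
      Delta_tilde_def proj_alpha_def)

lemma multiplicative_delta_word: "multiplicative delta_word"
  by (simp add: delta_word_def multiplicative_word_map)

lemma multiplicative_Delta_p_word: "multiplicative Delta_p_word"
  by (simp add: Delta_p_word_def multiplicative_word_map)

lemma multiplicative_Delta_alpha_monomial: "multiplicative Delta_alpha_monomial"
  by (simp add: Delta_alpha_monomial_def multiplicative_def)

lemma delta_word_letter:
  "delta_word (letter t) =
    lin (\<lambda>x. basis (letter (fst x), monomial_of (snd x))) (delta_tilde_tree t)"
  unfolding delta_word_def by (rule word_map_letter) (simp add: letter_Leaf)

lemma Delta_p_word_letter:
  "Delta_p_word (letter t) =
    lin (\<lambda>x. basis (letter (fst x), letter (snd x))) (Delta_p_tree t)"
  unfolding Delta_p_word_def by (rule word_map_letter) (simp add: letter_Leaf)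

lemma monomial_of_zero [simp]: "monomial_of 0 = 0"
  by (simp add: zero_pbt_def)

text \<open>The coproduct \<open>\<Delta>\<^sup>\<alpha>\<close> is prescribed on the generators \<open>V(t)\<close> only. Its relation to \<open>\<Delta>\<close>-tilde extends
  to all trees because both are multiplicative for the over product.\<close>

lemma Delta_alpha_monomial_of:
  "Delta_alpha_monomial (monomial_of t) =
    lin (\<lambda>x. basis (monomial_of (fst x), monomial_of (snd x))) (Delta_tilde_tree t)"
proof (induction t)
  case Leaf
  show ?case
    by (simp add: Delta_alpha_monomial_def Leaf_eq_zero)
next
  case (Graft t s)
  have "multiplicative (\<lambda>x. basis (monomial_of (fst x), monomial_of (snd x)))"
    by (rule multiplicative_basis) (simp_all add: monomial_of_over monomial_of_zero)
  then have "lin (\<lambda>x. basis (monomial_of (fst x), monomial_of (snd x))) (Delta_tilde_tree (Graft t s)) =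
      Delta_alpha_monomial (monomial_of t) *
        lin (\<lambda>x. basis (monomial_of (fst x), monomial_of (snd x))) (Delta_tilde_tree (V_tree s))"
    unfolding Delta_tilde_tree_Graft Graft by (rule lin_multiplicative)
  then show ?case
    by (simp add: Delta_alpha_monomial_def mult.commute)
qed

lemma delta_word_coaction:
  "act_left delta_word (delta_word w) = act_right Delta_alpha_monomial (delta_word w)"
proof (rule multiplicative_word_eqI[where w = w])
  show "multiplicative (\<lambda>w. act_left delta_word (delta_word w))"
    unfolding act_left_def
    by (intro multiplicative_lin multiplicative_on_left multiplicative_delta_word)
  show "multiplicative (\<lambda>w. act_right Delta_alpha_monomial (delta_word w))"
    unfolding act_right_def
    by (intro multiplicative_lin multiplicative_on_right multiplicative_delta_word
        multiplicative_Delta_alpha_monomial)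
  show "act_left delta_word (delta_word (letter t)) =
      act_right Delta_alpha_monomial (delta_word (letter t))" for t
    using arg_cong[OF conjunct2[OF tilde_coassoc[of t]],
        of "lin (\<lambda>x. basis (letter (fst x), monomial_of (fst (snd x)), monomial_of (snd (snd x))))"]
    by (simp add: act_left_def act_right_def delta_word_letter Delta_alpha_monomial_of)
qed

lemma Delta_p_word_coassoc:
  "act_left Delta_p_word (Delta_p_word w) = act_right Delta_p_word (Delta_p_word w)"
proof (rule multiplicative_word_eqI[where w = w])
  show "multiplicative (\<lambda>w. act_left Delta_p_word (Delta_p_word w))"
    unfolding act_left_def
    by (intro multiplicative_lin multiplicative_on_left multiplicative_Delta_p_word)
  show "multiplicative (\<lambda>w. act_right Delta_p_word (Delta_p_word w))"
    unfolding act_right_def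
    by (intro multiplicative_lin multiplicative_on_right multiplicative_Delta_p_word)
  show "act_left Delta_p_word (Delta_p_word (letter t)) =
      act_right Delta_p_word (Delta_p_word (letter t))" for t
    using arg_cong[OF coassoc_p_tree[of t],
        of "lin (\<lambda>x. basis (letter (fst x), letter (fst (snd x)), letter (snd (snd x))))"]
    by (simp add: act_left_def act_right_def Delta_p_word_letter)
qed

text \<open>Multiplicativity amounts to \<open>(b\<^sub>\<alpha> b'\<^sub>\<alpha>) (c\<^sub>\<alpha> c'\<^sub>\<alpha>) = (b\<^sub>\<alpha> c\<^sub>\<alpha>) (b'\<^sub>\<alpha> c'\<^sub>\<alpha>)\<close>, which is why the third
  factor must be commutative.\<close>

lemma multiplicative_act_diag:
  fixes f :: "'a::monoid_add \<Rightarrow> ('b::monoid_add \<times> 'c::comm_monoid_add) vec"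
  assumes "multiplicative f"
  shows "multiplicative (\<lambda>x. act_diag f (basis x))"
proof -
  have "multiplicative (\<lambda>x. lin (\<lambda>z. basis (fst (fst z), fst (snd z), snd (fst z) + snd (snd z)))
      (tensor (f (fst x)) (f (snd x))))"
    by (intro multiplicative_lin multiplicative_tensor multiplicative_basis assms)
      (simp_all add: ac_simps)
  then show ?thesis
    by (simp add: act_diag_def tensor_eq_lin)
qed

lemma delta_Delta_p_compatible:
  "act_left Delta_p_word (delta_word w) = act_diag delta_word (Delta_p_word w)"
proof (rule multiplicative_word_eqI[where w = w])
  show "multiplicative (\<lambda>w. act_left Delta_p_word (delta_word w))"
    unfolding act_left_def
    by (intro multiplicative_lin multiplicative_on_left multiplicative_Delta_p_word
        multiplicative_delta_word)
  have "multiplicative (\<lambda>w. lin (\<lambda>x. act_diag delta_word (basis x)) (Delta_p_word w))"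
    by (intro multiplicative_lin multiplicative_act_diag multiplicative_Delta_p_word
        multiplicative_delta_word)
  then show "multiplicative (\<lambda>w. act_diag delta_word (Delta_p_word w))"
    by (simp add: act_diag_def)
  show "act_left Delta_p_word (delta_word (letter t)) =
      act_diag delta_word (Delta_p_word (letter t))" for t
    using arg_cong[OF delta_p_compatible_tree[of t],
        of "lin (\<lambda>x. basis (letter (fst x), letter (fst (snd x)), monomial_of (snd (snd x))))"]
    by (simp add: act_left_def act_diag_def Delta_p_word_letter delta_word_letter monomial_of_over)
qed

section \<open>The coaction\<close>

lemma Delta_e_eq_lin:
  "Delta_e = lin (\<lambda>w.
    lin (\<lambda>x. lin (\<lambda>y. basis (fst y, snd y, snd x)) (delta_word (fst x))) (Delta_p_word w))"
  by (rule ext) (simp add: Delta_e_def tensor_map_eq_lin tensor_assoc_def split_beta'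
      delta_e_eq_lin Delta_p_eq_lin)

lemma Delta_qed_basis:
  "Delta_qed (basis (m, w)) =
    lin (\<lambda>y. lin (\<lambda>x. lin (\<lambda>z. basis ((fst y, fst z), (snd y + snd z, snd x)))
      (delta_word (fst x))) (Delta_p_word w)) (Delta_alpha_monomial m)"
  by (simp add: Delta_qed_def tensor_map_eq_lin split_beta'
      delta_e_eq_lin Delta_p_eq_lin Delta_alpha_eq_lin)

theorem mainTheorem3:
  shows "tensor_assoc \<circ> tensor_map Delta_e id \<circ> Delta_e = tensor_map id Delta_qed \<circ> Delta_e"
proof -
  \<comment> \<open>The three structural facts under an arbitrary linear map \<open>k\<close> on the triple tensor product, which
    is the form needed to apply them inside a longer expression.\<close>
  have coassoc: "lin (\<lambda>x. lin (\<lambda>y. k (fst y) (snd y) (snd x)) (Delta_p_word (fst x))) (Delta_p_word w) =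
      lin (\<lambda>x. lin (\<lambda>y. k (fst x) (fst y) (snd y)) (Delta_p_word (snd x))) (Delta_p_word w)"
    for k :: "word \<Rightarrow> word \<Rightarrow> word \<Rightarrow> (word \<times> qed_basis \<times> qed_basis) vec" and w
    using arg_cong[OF Delta_p_word_coassoc, of "lin (\<lambda>x. k (fst x) (fst (snd x)) (snd (snd x)))"]
    by (simp add: act_left_def act_right_def)
  have coaction: "lin (\<lambda>x. lin (\<lambda>y. k (fst y) (snd y) (snd x)) (delta_word (fst x))) (delta_word w) =
      lin (\<lambda>x. lin (\<lambda>y. k (fst x) (fst y) (snd y)) (Delta_alpha_monomial (snd x))) (delta_word w)"
    for k :: "word \<Rightarrow> monomial \<Rightarrow> monomial \<Rightarrow> (word \<times> qed_basis \<times> qed_basis) vec" and w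
    using arg_cong[OF delta_word_coaction, of "lin (\<lambda>x. k (fst x) (fst (snd x)) (snd (snd x)))"]
    by (simp add: act_left_def act_right_def)
  have compatible: "lin (\<lambda>x. lin (\<lambda>y. k (fst y) (snd y) (snd x)) (Delta_p_word (fst x))) (delta_word w) =
      lin (\<lambda>x. lin (\<lambda>y. lin (\<lambda>z. k (fst y) (fst z) (snd y + snd z))
        (delta_word (snd x))) (delta_word (fst x))) (Delta_p_word w)"
    for k :: "word \<Rightarrow> word \<Rightarrow> monomial \<Rightarrow> (word \<times> qed_basis \<times> qed_basis) vec" and w
    using arg_cong[OF delta_Delta_p_compatible, of "lin (\<lambda>x. k (fst x) (fst (snd x)) (snd (snd x)))"]
    by (simp add: act_left_def act_diag_def)
  \<comment> \<open>Both sides of the claim on a word \<open>w\<close>, with all definitions unfolded.\<close>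
  have "lin (\<lambda>a. lin (\<lambda>e. lin (\<lambda>c. lin (\<lambda>g. basis (fst g, (snd g, snd c), (snd e, snd a)))
            (delta_word (fst c))) (Delta_p_word (fst e))) (delta_word (fst a))) (Delta_p_word w) =
    lin (\<lambda>a. lin (\<lambda>x. lin (\<lambda>m. lin (\<lambda>b. lin (\<lambda>e.
            basis (fst x, (fst m, fst e), (snd m + snd e, snd b)))
            (delta_word (fst b))) (Delta_p_word (snd a))) (Delta_alpha_monomial (snd x)))
            (delta_word (fst a))) (Delta_p_word w)" (is "?L = ?R") for w
  proof -
    have "?L = lin (\<lambda>a. lin (\<lambda>p. lin (\<lambda>c. lin (\<lambda>f. lin (\<lambda>g.
            basis (fst g, (snd g, fst f), (snd c + snd f, snd a)))
            (delta_word (fst c))) (delta_word (snd p))) (delta_word (fst p)))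
            (Delta_p_word (fst a))) (Delta_p_word w)"
      by (simp only: compatible[of "\<lambda>c f m. lin (\<lambda>g. basis (fst g, (snd g, f), (m, snd a)))
          (delta_word c)" for a])
    \<comment> \<open>Exchanging \<open>c\<close> and \<open>f\<close> makes the two applications of \<open>\<delta>\<^sup>e\<close> to the first factor adjacent.\<close>
    also have "\<dots> = lin (\<lambda>a. lin (\<lambda>p. lin (\<lambda>f. lin (\<lambda>c. lin (\<lambda>g.
            basis (fst g, (snd g, fst f), (snd c + snd f, snd a)))
            (delta_word (fst c))) (delta_word (fst p))) (delta_word (snd p)))
            (Delta_p_word (fst a))) (Delta_p_word w)"
      by (subst lin_swap) (rule refl)
    also have "\<dots> = lin (\<lambda>a. lin (\<lambda>p. lin (\<lambda>f. lin (\<lambda>x. lin (\<lambda>m.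
            basis (fst x, (fst m, fst f), (snd m + snd f, snd a)))
            (Delta_alpha_monomial (snd x))) (delta_word (fst p))) (delta_word (snd p)))
            (Delta_p_word (fst a))) (Delta_p_word w)"
      by (simp only: coaction[of "\<lambda>g n m. basis (g, (n, fst f), (m + snd f, b))" for f b])
    also have "\<dots> = lin (\<lambda>a. lin (\<lambda>p. lin (\<lambda>f. lin (\<lambda>x. lin (\<lambda>m.
            basis (fst x, (fst m, fst f), (snd m + snd f, snd p)))
            (Delta_alpha_monomial (snd x))) (delta_word (fst a))) (delta_word (fst p)))
            (Delta_p_word (snd a))) (Delta_p_word w)"
      by (rule coassoc[of "\<lambda>a1 a2 a3. lin (\<lambda>f. lin (\<lambda>x. lin (\<lambda>m.
            basis (fst x, (fst m, fst f), (snd m + snd f, a3)))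
            (Delta_alpha_monomial (snd x))) (delta_word a1)) (delta_word a2)"])
    also have "\<dots> = ?R"
      by (subst lin_swap_dependent) (rule refl)
    finally show ?thesis .
  qed
  then show ?thesis
    by (intro ext) (simp add: Delta_e_eq_lin Delta_qed_basis tensor_map_eq_lin tensor_assoc_def split_beta')
qed

end
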